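(* Let $-\frac12<\nu<1$. Then for all $f\in L^2(\mathbb{R}^3_v)$, $$\langle L_\nu f,f\rangle_{L^2_v}\le-\min\Big\{1,\frac{1-|\nu|}{1-\nu}\Big\}\,\|(I-P_0)f\|^2_{L^2_v}.$$
   Context: $\mu(v)=(2\pi)^{-3/2}e^{-|v|^2/2}$ on $\mathbb{R}^3$; $\langle\cdot,\cdot\rangle_{L^2_v}$ and $\|\cdot\|_{L^2_v}$ are the standard (real) inner product and norm on $L^2(\mathbb{R}^3)$. The linearized ES-BGK relaxation operator is $L_\nu f=\frac{1}{1-\nu}(P_\nu f-f)$ with $P_\nu=P_0+\nu(P_1+P_2)$, where $$P_0f=\Big(\int f\sqrt\mu\,dv\Big)\sqrt\mu+\Big(\int fv\sqrt\mu\,dv\Big)\cdot v\sqrt\mu+\Big(\int f\tfrac{|v|^2-3}{\sqrt6}\sqrt\mu\,dv\Big)\tfrac{|v|^2-3}{\sqrt6}\sqrt\mu,$$ $$P_1f=\sum_{i=1}^3\Big(\int f\,\tfrac{3v_i^2-|v|^2}{3\sqrt2}\sqrt\mu\,dv\Big)\tfrac{3v_i^2-|v|^2}{3\sqrt2}\sqrt\mu,\qquad P_2f=\sum_{(i,j)\in\{(1,2),(2,3),(3,1)\}}\Big(\int fv_iv_j\sqrt\mu\,dv\Big)v_iv_j\sqrt\mu.$$ *)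

theory Defs
  imports "HOL-Analysis.Analysis"
begin

type_synonym velocity = "real ^ 3"

definition maxwellian :: "velocity \<Rightarrow> real" where
  "maxwellian v = (2 * pi) powr (- 3 / 2) * exp (- (norm v)\<^sup>2 / 2)"

text \<open>
  Elements of \<open>L\<^sup>2\<close> are represented by real-valued Lebesgue measurable functions rather than by
  equivalence classes modulo null sets; every operator below respects almost-everywhere equality.
\<close>

definition L2v :: "(velocity \<Rightarrow> real) set" where
  "L2v = {f. f \<in> borel_measurable lebesgue \<and> integrable lebesgue (\<lambda>v. (f v)\<^sup>2)}"

definition inner_L2v :: "(velocity \<Rightarrow> real) \<Rightarrow> (velocity \<Rightarrow> real) \<Rightarrow> real" where
  "inner_L2v f g = (\<integral>v. f v * g v \<partial>lebesgue)"

definition norm_L2v :: "(velocity \<Rightarrow> real) \<Rightarrow> real" where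
  "norm_L2v f = sqrt (\<integral>v. (f v)\<^sup>2 \<partial>lebesgue)"

text \<open>
  For \<open>f \<in> L2v\<close> every integral in the following operators converges, since polynomials times
  \<open>sqrt maxwellian\<close> are square integrable. In \<open>P0\<close> the momentum integral is vector-valued.
\<close>

definition P0 :: "(velocity \<Rightarrow> real) \<Rightarrow> velocity \<Rightarrow> real" where
  "P0 f v =
     (\<integral>w. f w * sqrt (maxwellian w) \<partial>lebesgue) * sqrt (maxwellian v)
   + ((\<integral>w. (f w * sqrt (maxwellian w)) *\<^sub>R w \<partial>lebesgue) \<bullet> v) * sqrt (maxwellian v)
   + (\<integral>w. f w * (((norm w)\<^sup>2 - 3) / sqrt 6) * sqrt (maxwellian w) \<partial>lebesgue)
       * (((norm v)\<^sup>2 - 3) / sqrt 6) * sqrt (maxwellian v)"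

definition P1 :: "(velocity \<Rightarrow> real) \<Rightarrow> velocity \<Rightarrow> real" where
  "P1 f v = (\<Sum>i\<in>UNIV.
     (\<integral>w. f w * ((3 * (w $ i)\<^sup>2 - (norm w)\<^sup>2) / (3 * sqrt 2)) * sqrt (maxwellian w) \<partial>lebesgue)
       * ((3 * (v $ i)\<^sup>2 - (norm v)\<^sup>2) / (3 * sqrt 2)) * sqrt (maxwellian v))"

definition P2 :: "(velocity \<Rightarrow> real) \<Rightarrow> velocity \<Rightarrow> real" where
  "P2 f v = (\<Sum>(i, j)\<in>{(1, 2), (2, 3), (3, 1)}.
     (\<integral>w. f w * (w $ i) * (w $ j) * sqrt (maxwellian w) \<partial>lebesgue)
       * (v $ i) * (v $ j) * sqrt (maxwellian v))"

definition P_nu :: "real \<Rightarrow> (velocity \<Rightarrow> real) \<Rightarrow> velocity \<Rightarrow> real" where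
  "P_nu \<nu> f v = P0 f v + \<nu> * (P1 f v + P2 f v)"

definition L_nu :: "real \<Rightarrow> (velocity \<Rightarrow> real) \<Rightarrow> velocity \<Rightarrow> real" where
  "L_nu \<nu> f v = 1 / (1 - \<nu>) * (P_nu \<nu> f v - f v)"

end

theory Submission
  imports Defs "HOL-Probability.Distributions"
begin

text \<open>
  The products of normalized Hermite polynomials of total degree at most two, times the square root
  of the Maxwellian, are orthonormal. In this basis \<open>P0\<close> keeps the Hermite coefficients of degree at
  most one and replaces the three pure second-degree ones by their mean, while \<open>P1 + P2\<close> keeps what
  remains of the second-degree part. So \<open>P0\<close> and \<open>P1 + P2\<close> are orthogonal projections with
  orthogonal ranges, and Bessel's inequality gives
  \<open>0 \<le> \<langle>(P1 + P2) f, f\<rangle> \<le> \<parallel>(I - P0) f\<parallel>\<^sup>2\<close>. As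
  \<open>(1 - \<nu>) \<langle>L f, f\<rangle> = \<nu> \<langle>(P1 + P2) f, f\<rangle> - \<parallel>(I - P0) f\<parallel>\<^sup>2\<close>, the estimate follows from the upper
  bound for \<open>\<nu> \<ge> 0\<close> and from the lower bound for \<open>\<nu> < 0\<close>.
\<close>

section \<open>Fubini's theorem for products of functions of single coordinates\<close>

text \<open>Lebesgue measure on \<open>real^'n\<close> is the image of a product of one-dimensional
  measures indexed by \<open>Basis\<close>, so the product formula carries over once coordinates are
  matched with basis vectors.\<close>

lemma has_bochner_integral_lborel_vec_prod:
  fixes g :: "'n::finite \<Rightarrow> real \<Rightarrow> real"
  assumes int: "\<And>i. integrable lborel (g i)"
  shows "has_bochner_integral lborel (\<lambda>v::real^'n. \<Prod>i\<in>UNIV. g i (v $ i))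
           (\<Prod>i\<in>UNIV. integral\<^sup>L lborel (g i))"
proof -
  interpret product_sigma_finite "\<lambda>b::real^'n. lborel :: real measure" ..
  \<comment> \<open>The factors are re-indexed by basis vectors; \<open>THE\<close> recovers the
    coordinate, which is unique because \<open>axis\<close> is injective in its index.\<close>
  define h where "h b = g (THE i. b = axis i (1::real))" for b :: "real^'n"
  have h_axis: "h (axis i 1) = g i" for i
    by (simp add: h_def axis_eq_axis)
  have basis: "(Basis :: (real^'n) set) = (\<lambda>i. axis i 1) ` UNIV"
    by (auto simp: Basis_vec_def)
  have inj: "inj (\<lambda>i::'n. axis i (1::real))"
    by (simp add: inj_on_def axis_eq_axis)
  have int_h: "integrable lborel (h b)" if "b \<in> Basis" for b
    using that int by (auto simp: basis h_axis)
  have g_meas [measurable]: "g i \<in> borel_measurable borel" for i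
    using borel_measurable_integrable[OF int] by simp
  have comp: "(\<Sum>b\<in>Basis. x b *\<^sub>R b) $ i = x (axis i 1)" for x :: "real^'n \<Rightarrow> real" and i
  proof -
    have "axis j (1::real) $ i = (if i = j then 1 else 0)" for j
      by (simp add: axis_def)
    then have "(\<Sum>j\<in>UNIV. x (axis j 1) * axis j 1 $ i) = (\<Sum>j\<in>UNIV. if i = j then x (axis j 1) else 0)"
      by (intro sum.cong) simp_all
    then show ?thesis
      by (simp add: basis sum.reindex[OF inj])
  qed
  have prod_h: "(\<Prod>i\<in>UNIV. g i ((\<Sum>b\<in>Basis. x b *\<^sub>R b) $ i)) = (\<Prod>b\<in>Basis. h b (x b))"
    for x :: "real^'n \<Rightarrow> real"
    by (simp only: comp) (simp add: basis prod.reindex[OF inj] h_axis)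
  have "has_bochner_integral (\<Pi>\<^sub>M b\<in>Basis. lborel) (\<lambda>x. \<Prod>b\<in>Basis. h b (x b))
          (\<Prod>b\<in>(Basis :: (real^'n) set). integral\<^sup>L lborel (h b))"
    by (simp add: has_bochner_integral_iff product_integrable_prod product_integral_prod int_h)
  also have "(\<Prod>b\<in>(Basis :: (real^'n) set). integral\<^sup>L lborel (h b)) = (\<Prod>i\<in>UNIV. integral\<^sup>L lborel (g i))"
    by (simp add: basis prod.reindex[OF inj] h_axis)
  finally have prod: "has_bochner_integral (\<Pi>\<^sub>M b\<in>Basis. lborel)
      (\<lambda>x. \<Prod>i\<in>UNIV. g i ((\<Sum>b\<in>(Basis :: (real^'n) set). x b *\<^sub>R b) $ i))
      (\<Prod>i\<in>UNIV. integral\<^sup>L lborel (g i))"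
    by (simp only: prod_h)
  have [measurable]: "(\<lambda>v::real^'n. v $ i) \<in> borel_measurable borel" for i
    by (intro borel_measurable_continuous_onI continuous_intros)
  have "(\<lambda>v::real^'n. \<Prod>i\<in>UNIV. g i (v $ i)) \<in> borel_measurable borel"
    by measurable
  moreover have "(\<lambda>x. \<Sum>b\<in>(Basis :: (real^'n) set). x b *\<^sub>R b) \<in> (\<Pi>\<^sub>M b\<in>Basis. lborel) \<rightarrow>\<^sub>M borel"
    by measurable
  ultimately show ?thesis
    using prod by (subst lborel_eq) (simp only: has_bochner_integral_distr)
qed

section \<open>Normalized Hermite polynomials in one variable\<close>

text \<open>All degrees above two repeat the degree-two polynomial; only degrees at most two are used.\<close>

fun hermite :: "nat \<Rightarrow> real \<Rightarrow> real" where
  "hermite 0 x = 1"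
| "hermite (Suc 0) x = x"
| "hermite (Suc (Suc _)) x = (x\<^sup>2 - 1) / sqrt 2"

lemma hermite_2: "hermite 2 x = (x\<^sup>2 - 1) / sqrt 2"
  by (simp add: numeral_2_eq_2)

lemma std_normal_moments:
  "has_bochner_integral lborel std_normal_density 1"
  "has_bochner_integral lborel (\<lambda>x. std_normal_density x * x) 0"
  "has_bochner_integral lborel (\<lambda>x. std_normal_density x * x ^ 2) 1"
  "has_bochner_integral lborel (\<lambda>x. std_normal_density x * x ^ 3) 0"
  "has_bochner_integral lborel (\<lambda>x. std_normal_density x * x ^ 4) 3"
  using std_normal_moment_even[of 0] std_normal_moment_odd[of 0] std_normal_moment_even[of 1]
    std_normal_moment_odd[of 1] std_normal_moment_even[of 2]
  by (simp_all add: fact_numeral eval_nat_numeral)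

lemma hermite_orthonormal:
  assumes "a \<le> 2" "b \<le> 2"
  shows "has_bochner_integral lborel (\<lambda>x. hermite a x * hermite b x * std_normal_density x)
           (if a = b then 1 else 0)"
proof -
  note m = std_normal_moments
  have 2: "has_bochner_integral lborel (\<lambda>x. hermite 2 x * std_normal_density x) 0"
    using has_bochner_integral_mult_left[OF has_bochner_integral_diff[OF m(3) m(1)], of "1 / sqrt 2"]
    by (simp add: numeral_2_eq_2 field_simps)
  have 12: "has_bochner_integral lborel (\<lambda>x. x * hermite 2 x * std_normal_density x) 0"
    using has_bochner_integral_mult_left[OF has_bochner_integral_diff[OF m(4) m(2)], of "1 / sqrt 2"]
    by (simp add: numeral_2_eq_2 numeral_3_eq_3 field_simps)
  \<comment> \<open>Expanding (x^2 - 1)^2 / 2 gives (3 - 2 + 1) / 2 = 1, which is why the degree-two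
    polynomial carries the factor \<open>1 / sqrt 2\<close>.\<close>
  have "has_bochner_integral lborel (\<lambda>x. (std_normal_density x * x ^ 4
          - 2 * (std_normal_density x * x ^ 2) + std_normal_density x) * (1 / 2)) ((3 - 2 * 1 + 1) * (1 / 2))"
    by (intro has_bochner_integral_mult_left has_bochner_integral_mult_right has_bochner_integral_add
        has_bochner_integral_diff m)
  also have "(\<lambda>x. (std_normal_density x * x ^ 4 - 2 * (std_normal_density x * x ^ 2)
        + std_normal_density x) * (1 / 2)) = (\<lambda>x. hermite 2 x * hermite 2 x * std_normal_density x)"
    by (simp add: fun_eq_iff numeral_2_eq_2 field_simps eval_nat_numeral)
  finally have 22: "has_bochner_integral lborel (\<lambda>x. hermite 2 x * hermite 2 x * std_normal_density x) 1"
    by simp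
  have ab: "a = 0 \<or> a = Suc 0 \<or> a = 2" "b = 0 \<or> b = Suc 0 \<or> b = 2"
    using assms by auto
  show ?thesis
    using ab m(1-3) 2 12 22
    by (elim disjE) (simp_all add: mult_ac power2_eq_square)
qed

section \<open>Orthonormal Hermite functions on velocity space\<close>

text \<open>With the square root of the Maxwellian in each function, a product of two carries the
  full Gaussian weight.\<close>

definition hermite_fun :: "nat \<times> nat \<times> nat \<Rightarrow> velocity \<Rightarrow> real" where
  "hermite_fun = (\<lambda>(a, b, c) v.
     hermite a (v $ 1) * hermite b (v $ 2) * hermite c (v $ 3) * sqrt (maxwellian v))"

text \<open>The ten multi-indices of total degree at most two; the mixed ones correspond in order to
  the pairs (1,2), (2,3), (3,1) of \<open>P2\<close>.\<close>

definition hermite_indices :: "(nat \<times> nat \<times> nat) set" where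
  "hermite_indices = {(0,0,0), (1,0,0), (0,1,0), (0,0,1), (2,0,0), (0,2,0), (0,0,2),
     (1,1,0), (0,1,1), (1,0,1)}"

lemma prod_UNIV_3: "prod f (UNIV :: 3 set) = f 1 * f 2 * f 3"
  unfolding UNIV_3 by (simp add: ac_simps)

lemma norm_sq_3: "(norm (v :: real ^ 3))\<^sup>2 = (v $ 1)\<^sup>2 + (v $ 2)\<^sup>2 + (v $ 3)\<^sup>2"
  by (simp add: norm_eq_sqrt_inner inner_vec_def sum_3 power2_eq_square)

lemma maxwellian_nonneg: "0 \<le> maxwellian v"
  by (simp add: maxwellian_def)

lemma maxwellian_eq_prod: "maxwellian v = (\<Prod>i\<in>UNIV. std_normal_density (v $ i))"
proof -
  have "(2 * pi) powr (- 3 / 2) = ((2 * pi) powr (- 1 / 2)) ^ 3"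
    by (simp add: powr_power)
  also have "(2 * pi) powr (- 1 / 2) = 1 / sqrt (2 * pi)"
    by (simp add: powr_minus_divide powr_half_sqrt)
  finally have c: "(2 * pi) powr (- 3 / 2) = (1 / sqrt (2 * pi)) ^ 3" .
  have e: "exp (- (norm v)\<^sup>2 / 2)
      = exp (- (v $ 1)\<^sup>2 / 2) * exp (- (v $ 2)\<^sup>2 / 2) * exp (- (v $ 3)\<^sup>2 / 2)"
    by (simp add: norm_sq_3 field_simps flip: exp_add)
  show ?thesis
    unfolding maxwellian_def c e prod_UNIV_3 std_normal_density_def
    by (simp add: power3_eq_cube)
qed

lemma borel_measurable_hermite [measurable]: "hermite a \<in> borel_measurable borel"
proof (cases "(a, 0 :: real)" rule: hermite.cases)
  case (1 x)
  then have "hermite a = (\<lambda>x. 1)" by auto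
  then show ?thesis by simp
next
  case (2 x)
  then have "hermite a = (\<lambda>x. x)" by auto
  then show ?thesis by simp
next
  case (3 n x)
  then have "hermite a = (\<lambda>x. (x\<^sup>2 - 1) / sqrt 2)" by auto
  then show ?thesis by simp
qed

lemma borel_measurable_hermite_fun: "hermite_fun k \<in> borel_measurable borel"
proof -
  have [measurable]: "(\<lambda>v::velocity. v $ i) \<in> borel_measurable borel" for i
    by (intro borel_measurable_continuous_onI continuous_intros)
  show ?thesis
    unfolding hermite_fun_def maxwellian_def by (cases k) simp
qed

text \<open>The Maxwellian factors over the coordinates, so the integral is a product of three
  one-dimensional ones, each a Kronecker delta.\<close>

lemma hermite_fun_orthonormal:
  assumes "k \<in> hermite_indices" "l \<in> hermite_indices"
  shows "has_bochner_integral lebesgue (\<lambda>v. hermite_fun k v * hermite_fun l v)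
           (if k = l then 1 else 0)"
proof -
  obtain a b c where k: "k = (a, b, c)" by (cases k)
  obtain a' b' c' where l: "l = (a', b', c')" by (cases l)
  have le: "a \<le> 2" "b \<le> 2" "c \<le> 2" "a' \<le> 2" "b' \<le> 2" "c' \<le> 2"
    using assms by (auto simp: k l hermite_indices_def)
  define m n where "m i = (if i = 1 then a else if i = 2 then b else c)"
    and "n i = (if i = 1 then a' else if i = 2 then b' else c')" for i :: 3
  have mn: "m i \<le> 2" "n i \<le> 2" for i
    using le by (auto simp: m_def n_def)
  define g where "g i x = hermite (m i) x * hermite (n i) x * std_normal_density x" for i x
  have g: "has_bochner_integral lborel (g i) (if m i = n i then 1 else 0)" for i
    unfolding g_def by (rule hermite_orthonormal[OF mn])
  have "(\<lambda>v. hermite_fun k v * hermite_fun l v) = (\<lambda>v. \<Prod>i\<in>UNIV. g i (v $ i))"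
  proof
    fix v
    have "sqrt (maxwellian v) * sqrt (maxwellian v) = (\<Prod>i\<in>UNIV. std_normal_density (v $ i))"
      using maxwellian_nonneg[of v] by (simp add: maxwellian_eq_prod)
    then show "hermite_fun k v * hermite_fun l v = (\<Prod>i\<in>UNIV. g i (v $ i))"
      by (simp add: hermite_fun_def k l g_def prod_UNIV_3 m_def n_def)
  qed
  moreover have "(\<Prod>i\<in>UNIV. integral\<^sup>L lborel (g i)) = (if k = l then 1 else 0)"
    by (simp add: has_bochner_integral_integral_eq[OF g] prod_UNIV_3 m_def n_def k l)
  ultimately have "has_bochner_integral lborel (\<lambda>v. hermite_fun k v * hermite_fun l v)
      (if k = l then 1 else 0)"
    using has_bochner_integral_lborel_vec_prod[of g, OF integrable.intros, OF g] by simp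
  \<comment> \<open>\<open>lebesgue\<close> is the completion of \<open>lborel\<close>, and the
    integral of a Borel function is the same for both.\<close>
  then show ?thesis
    by (auto simp: has_bochner_integral_iff integrable_completion integral_completion
        borel_measurable_hermite_fun)
qed

section \<open>Hermite coefficients and finite Hermite expansions\<close>

lemma integrable_mult_L2v:
  assumes "f \<in> L2v" "g \<in> L2v"
  shows "integrable lebesgue (\<lambda>v. f v * g v)"
proof (rule Bochner_Integration.integrable_bound)
  show "integrable lebesgue (\<lambda>v. (f v)\<^sup>2 + (g v)\<^sup>2)"
    using assms by (simp add: L2v_def)
  show "(\<lambda>v. f v * g v) \<in> borel_measurable lebesgue"
    using assms by (intro borel_measurable_times) (auto simp: L2v_def)
  have "\<bar>x * y\<bar> \<le> x\<^sup>2 + y\<^sup>2" for x y :: real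
    using sum_squares_bound[of "\<bar>x\<bar>" "\<bar>y\<bar>"] mult_nonneg_nonneg[OF abs_ge_zero[of x] abs_ge_zero[of y]]
    unfolding abs_mult power2_abs by linarith
  then show "AE v in lebesgue. norm (f v * g v) \<le> norm ((f v)\<^sup>2 + (g v)\<^sup>2)"
    by simp
qed

lemma hermite_fun_L2v:
  assumes "k \<in> hermite_indices"
  shows "hermite_fun k \<in> L2v"
  using hermite_fun_orthonormal[OF assms assms] borel_measurable_hermite_fun[of k]
  by (auto simp: L2v_def has_bochner_integral_iff power2_eq_square measurable_completion)

definition hermite_coeff :: "(velocity \<Rightarrow> real) \<Rightarrow> nat \<times> nat \<times> nat \<Rightarrow> real" where
  "hermite_coeff f k = (\<integral>v. f v * hermite_fun k v \<partial>lebesgue)"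

lemma finite_hermite_indices [simp]: "finite hermite_indices"
  by (simp add: hermite_indices_def)

lemma has_integral_hermite_coeff:
  assumes "f \<in> L2v" "k \<in> hermite_indices"
  shows "has_bochner_integral lebesgue (\<lambda>v. f v * hermite_fun k v) (hermite_coeff f k)"
  unfolding hermite_coeff_def
  by (intro has_bochner_integral_integrable integrable_mult_L2v hermite_fun_L2v assms)

lemma has_integral_hermite_sum:
  assumes "f \<in> L2v"
  shows "has_bochner_integral lebesgue (\<lambda>v. (\<Sum>k\<in>hermite_indices. d k * hermite_fun k v) * f v)
           (\<Sum>k\<in>hermite_indices. d k * hermite_coeff f k)"
proof -
  have "has_bochner_integral lebesgue (\<lambda>v. \<Sum>k\<in>hermite_indices. d k * (f v * hermite_fun k v))
           (\<Sum>k\<in>hermite_indices. d k * hermite_coeff f k)"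
    by (intro has_bochner_integral_sum has_bochner_integral_mult_right
        has_integral_hermite_coeff assms)
  then show ?thesis
    by (simp add: sum_distrib_left mult_ac)
qed

text \<open>Parseval for finite expansions: in the double sum of the expanded square, orthonormality
  leaves only the diagonal.\<close>

lemma has_integral_hermite_sum_square:
  "has_bochner_integral lebesgue (\<lambda>v. (\<Sum>k\<in>hermite_indices. d k * hermite_fun k v)\<^sup>2)
     (\<Sum>k\<in>hermite_indices. (d k)\<^sup>2)"
proof -
  have "has_bochner_integral lebesgue
      (\<lambda>v. \<Sum>k\<in>hermite_indices. \<Sum>l\<in>hermite_indices. (d k * d l) * (hermite_fun k v * hermite_fun l v))
      (\<Sum>k\<in>hermite_indices. \<Sum>l\<in>hermite_indices. (d k * d l) * (if k = l then 1 else 0))"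
    by (intro has_bochner_integral_sum has_bochner_integral_mult_right hermite_fun_orthonormal)
  moreover have "(\<Sum>k\<in>hermite_indices. \<Sum>l\<in>hermite_indices. (d k * d l) * (if k = l then 1 else 0))
      = (\<Sum>k\<in>hermite_indices. (d k)\<^sup>2)"
    by (simp add: if_distrib power2_eq_square cong: if_cong)
  ultimately show ?thesis
    by (simp add: power2_eq_square sum_product mult_ac)
qed

text \<open>The coefficients \<open>d\<close> stay arbitrary for two uses: the Hermite coefficients
  of \<open>f\<close> give Bessel's inequality, and \<open>fluid_coeff f\<close> gives the norm of
  \<open>f - P0 f\<close>.\<close>

lemma has_integral_hermite_residual:
  assumes "f \<in> L2v"
  shows "has_bochner_integral lebesgue (\<lambda>v. (f v - (\<Sum>k\<in>hermite_indices. d k * hermite_fun k v))\<^sup>2)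
           ((\<integral>v. (f v)\<^sup>2 \<partial>lebesgue) - 2 * (\<Sum>k\<in>hermite_indices. d k * hermite_coeff f k)
             + (\<Sum>k\<in>hermite_indices. (d k)\<^sup>2))"
proof -
  have "has_bochner_integral lebesgue (\<lambda>v. (f v)\<^sup>2) (\<integral>v. (f v)\<^sup>2 \<partial>lebesgue)"
    using assms by (intro has_bochner_integral_integrable) (simp add: L2v_def)
  from has_bochner_integral_add[OF has_bochner_integral_diff[OF this
        has_bochner_integral_mult_right[OF has_integral_hermite_sum[OF assms, of d], of 2]]
      has_integral_hermite_sum_square[of d]]
  show ?thesis
    by (simp add: power2_diff algebra_simps)
qed

section \<open>The operators \<open>P0\<close> and \<open>P1 + P2\<close> in Hermite
  coordinates\<close>

definition trace_mean :: "(velocity \<Rightarrow> real) \<Rightarrow> real" where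
  "trace_mean f = (hermite_coeff f (2,0,0) + hermite_coeff f (0,2,0) + hermite_coeff f (0,0,2)) / 3"

text \<open>The Hermite coefficients of \<open>P0 f\<close>. Among the pure second-degree modes the
  energy mode points along (1,1,1), and projecting onto that direction replaces each coefficient by
  the mean.\<close>

definition fluid_coeff :: "(velocity \<Rightarrow> real) \<Rightarrow> nat \<times> nat \<times> nat \<Rightarrow> real" where
  "fluid_coeff f k =
     (if k \<in> {(2,0,0), (0,2,0), (0,0,2)} then trace_mean f
      else if k \<in> {(1,1,0), (0,1,1), (1,0,1)} then 0
      else hermite_coeff f k)"

lemma trace_identity:
  "((norm (v :: velocity))\<^sup>2 - 3) / sqrt 6
     = (hermite 2 (v $ 1) + hermite 2 (v $ 2) + hermite 2 (v $ 3)) / sqrt 3"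
proof -
  have "(norm v)\<^sup>2 - 3 = ((v $ 1)\<^sup>2 - 1) + ((v $ 2)\<^sup>2 - 1) + ((v $ 3)\<^sup>2 - 1)"
    by (simp add: norm_sq_3)
  moreover have "sqrt 6 = sqrt 2 * sqrt 3"
    by (simp flip: real_sqrt_mult)
  ultimately show ?thesis
    by (simp only: hermite_2 add_divide_distrib[symmetric] divide_divide_eq_left)
qed

text \<open>The numerator is three times the i-th \<open>x^2 - 1\<close> minus the sum of all three,
  since the constants cancel. Thus \<open>P1\<close> uses the projections of the pure modes onto the
  complement of (1,1,1).\<close>

lemma traceless_identity:
  "(3 * ((v :: velocity) $ i)\<^sup>2 - (norm v)\<^sup>2) / (3 * sqrt 2)
     = hermite 2 (v $ i) - (hermite 2 (v $ 1) + hermite 2 (v $ 2) + hermite 2 (v $ 3)) / 3"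
proof -
  define q where "q = 1 / sqrt 2"
  have "x / sqrt 2 = x * q" "x / (3 * sqrt 2) = x * q / 3" for x
    by (simp_all add: q_def)
  then show ?thesis
    by (simp only: hermite_2 norm_sq_3) (simp add: field_simps)
qed

lemma hermite_fun_simps:
  "hermite_fun (0,0,0) v = sqrt (maxwellian v)"
  "hermite_fun (1,0,0) v = v $ 1 * sqrt (maxwellian v)"
  "hermite_fun (0,1,0) v = v $ 2 * sqrt (maxwellian v)"
  "hermite_fun (0,0,1) v = v $ 3 * sqrt (maxwellian v)"
  "hermite_fun (2,0,0) v = hermite 2 (v $ 1) * sqrt (maxwellian v)"
  "hermite_fun (0,2,0) v = hermite 2 (v $ 2) * sqrt (maxwellian v)"
  "hermite_fun (0,0,2) v = hermite 2 (v $ 3) * sqrt (maxwellian v)"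
  "hermite_fun (1,1,0) v = v $ 1 * v $ 2 * sqrt (maxwellian v)"
  "hermite_fun (0,1,1) v = v $ 2 * v $ 3 * sqrt (maxwellian v)"
  "hermite_fun (1,0,1) v = v $ 3 * v $ 1 * sqrt (maxwellian v)"
  by (simp_all add: hermite_fun_def)

text \<open>The simplifier turns \<open>1 :: nat\<close> into \<open>Suc 0\<close>; these variants
  match the triples after that rewriting.\<close>

lemmas hermite_fun_simps' = hermite_fun_simps[unfolded One_nat_def]

lemma sum_hermite_indices:
  "sum d hermite_indices = d (0,0,0) + (d (1,0,0) + d (0,1,0) + d (0,0,1))
     + (d (2,0,0) + d (0,2,0) + d (0,0,2)) + (d (1,1,0) + d (0,1,1) + d (1,0,1))"
  for d :: "nat \<times> nat \<times> nat \<Rightarrow> real"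
  by (simp add: hermite_indices_def)

lemma hermite_coeff_trace:
  assumes "f \<in> L2v"
  shows "has_bochner_integral lebesgue
    (\<lambda>v. f v * ((hermite 2 (v $ 1) + hermite 2 (v $ 2) + hermite 2 (v $ 3)) * sqrt (maxwellian v)))
    (3 * trace_mean f)"
proof -
  have "has_bochner_integral lebesgue
      (\<lambda>v. f v * hermite_fun (2,0,0) v + f v * hermite_fun (0,2,0) v + f v * hermite_fun (0,0,2) v)
      (hermite_coeff f (2,0,0) + hermite_coeff f (0,2,0) + hermite_coeff f (0,0,2))"
    by (intro has_bochner_integral_add has_integral_hermite_coeff assms)
      (simp_all add: hermite_indices_def)
  moreover have "3 * trace_mean f
      = hermite_coeff f (2,0,0) + hermite_coeff f (0,2,0) + hermite_coeff f (0,0,2)"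
    by (simp add: trace_mean_def)
  ultimately show ?thesis
    by (simp add: hermite_fun_simps' algebra_simps)
qed

lemma P0_eq_hermite_sum:
  assumes f: "f \<in> L2v"
  shows "P0 f v = (\<Sum>k\<in>hermite_indices. fluid_coeff f k * hermite_fun k v)"
proof -
  have mass: "(\<integral>w. f w * sqrt (maxwellian w) \<partial>lebesgue) = hermite_coeff f (0,0,0)"
    by (simp add: hermite_coeff_def hermite_fun_simps')
  define F where "F w = (f w * sqrt (maxwellian w)) *\<^sub>R w" for w
  define c :: velocity where "c = vector [hermite_coeff f (1,0,0), hermite_coeff f (0,1,0), hermite_coeff f (0,0,1)]"
  \<comment> \<open>The vector-valued momentum integral is computed by splitting the integrand along
    the three axes.\<close>
  have "has_bochner_integral lebesgue
      (\<lambda>w. (f w * hermite_fun (1,0,0) w) *\<^sub>R axis 1 1 + (f w * hermite_fun (0,1,0) w) *\<^sub>R axis 2 1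
        + (f w * hermite_fun (0,0,1) w) *\<^sub>R axis 3 1)
      (hermite_coeff f (1,0,0) *\<^sub>R axis 1 1 + hermite_coeff f (0,1,0) *\<^sub>R axis 2 1
        + hermite_coeff f (0,0,1) *\<^sub>R axis 3 1 :: velocity)"
    by (intro has_bochner_integral_add has_bochner_integral_scaleR_left has_integral_hermite_coeff f)
      (simp_all add: hermite_indices_def)
  moreover have "(f w * hermite_fun (1,0,0) w) *\<^sub>R axis 1 1 + (f w * hermite_fun (0,1,0) w) *\<^sub>R axis 2 1
        + (f w * hermite_fun (0,0,1) w) *\<^sub>R axis 3 1 = F w" for w
    by (simp add: F_def vec_eq_iff forall_3 axis_def hermite_fun_simps')
  moreover have "hermite_coeff f (1,0,0) *\<^sub>R axis 1 1 + hermite_coeff f (0,1,0) *\<^sub>R axis 2 1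
        + hermite_coeff f (0,0,1) *\<^sub>R axis 3 1 = c"
    by (simp add: c_def vec_eq_iff forall_3 axis_def)
  ultimately have mom: "(\<integral>w. (f w * sqrt (maxwellian w)) *\<^sub>R w \<partial>lebesgue) = c"
    by (simp add: F_def has_bochner_integral_iff)
  \<comment> \<open>The factor \<open>1 / sqrt 3\<close> here meets another one in the energy mode
    itself, so each pure second-degree function receives exactly
    \<open>trace_mean f\<close>.\<close>
  have energy: "(\<integral>w. f w * (((norm w)\<^sup>2 - 3) / sqrt 6) * sqrt (maxwellian w) \<partial>lebesgue)
      = 3 * trace_mean f / sqrt 3"
    using has_bochner_integral_integral_eq[OF has_bochner_integral_divide_zero[OF hermite_coeff_trace[OF f], of "sqrt 3"]]
    by (simp add: trace_identity mult_ac)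
  show ?thesis
    unfolding P0_def mass mom energy unfolding trace_identity sum_hermite_indices
    by (simp add: fluid_coeff_def hermite_fun_simps' inner_vec_def sum_3 c_def field_simps)
qed

text \<open>The three functions in \<open>P1\<close> sum to zero and are not orthonormal, but as
  projections of an orthonormal triple they form a Parseval frame of the traceless plane, so
  \<open>P1\<close> is the projection onto it.\<close>

lemma P1_P2_eq_hermite_sum:
  assumes f: "f \<in> L2v"
  shows "P1 f v + P2 f v
    = (\<Sum>k\<in>hermite_indices. (hermite_coeff f k - fluid_coeff f k) * hermite_fun k v)"
proof -
  define s where "s v = (hermite 2 (v $ 1) + hermite 2 (v $ 2) + hermite 2 (v $ 3)) / 3" for v :: velocity
  have diag: "(\<integral>w. f w * ((3 * (w $ i)\<^sup>2 - (norm w)\<^sup>2) / (3 * sqrt 2)) * sqrt (maxwellian w) \<partial>lebesgue)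
      = hermite_coeff f k - trace_mean f"
    if "k \<in> hermite_indices" "\<And>w. hermite_fun k w = hermite 2 (w $ i) * sqrt (maxwellian w)" for i k
    using has_bochner_integral_integral_eq[OF has_bochner_integral_diff[OF
        has_integral_hermite_coeff[OF f that(1)]
        has_bochner_integral_divide_zero[OF hermite_coeff_trace[OF f], of 3]]]
    by (simp add: traceless_identity that(2) algebra_simps)
  have index: "(2,0,0) \<in> hermite_indices" "(0,2,0) \<in> hermite_indices" "(0,0,2) \<in> hermite_indices"
    by (simp_all add: hermite_indices_def)
  have P1: "P1 f v = ((hermite_coeff f (2,0,0) - trace_mean f) * (hermite 2 (v $ 1) - s v)
      + (hermite_coeff f (0,2,0) - trace_mean f) * (hermite 2 (v $ 2) - s v)
      + (hermite_coeff f (0,0,2) - trace_mean f) * (hermite 2 (v $ 3) - s v)) * sqrt (maxwellian v)"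
    unfolding P1_def sum_3 diag[OF index(1) hermite_fun_simps(5)]
      diag[OF index(2) hermite_fun_simps(6)] diag[OF index(3) hermite_fun_simps(7)]
    unfolding traceless_identity s_def[symmetric]
    by (simp add: algebra_simps)
  have P2: "P2 f v = hermite_coeff f (1,1,0) * hermite_fun (1,1,0) v
      + hermite_coeff f (0,1,1) * hermite_fun (0,1,1) v + hermite_coeff f (1,0,1) * hermite_fun (1,0,1) v"
    by (simp add: P2_def hermite_coeff_def hermite_fun_simps' mult_ac)
  \<comment> \<open>Eliminating one coefficient encodes that the deviations from the mean sum to
    zero, which cancels every term with \<open>s v\<close>.\<close>
  have trace: "hermite_coeff f (0,0,2) = 3 * trace_mean f - hermite_coeff f (2,0,0) - hermite_coeff f (0,2,0)"
    by (simp add: trace_mean_def field_simps)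
  show ?thesis
    unfolding P1 P2 sum_hermite_indices trace
    by (simp add: fluid_coeff_def hermite_fun_simps') (simp add: algebra_simps)
qed

text \<open>One factor vanishes at each index of degree at most one and at each mixed index; the
  pure ones contribute the mean times a zero sum of deviations.\<close>

lemma fluid_coeff_orthogonal:
  "(\<Sum>k\<in>hermite_indices. fluid_coeff f k * (hermite_coeff f k - fluid_coeff f k)) = 0"
  by (simp add: sum_hermite_indices fluid_coeff_def trace_mean_def field_simps)

section \<open>The coercivity estimate\<close>

theorem theorem2p8:
  fixes \<nu> :: real and f :: "real ^ 3 \<Rightarrow> real"
  assumes "- (1 / 2) < \<nu>" and "\<nu> < 1"
    and "f \<in> L2v"
  shows "inner_L2v (L_nu \<nu> f) f
       \<le> - min 1 ((1 - \<bar>\<nu>\<bar>) / (1 - \<nu>)) * (norm_L2v (\<lambda>v. f v - P0 f v))\<^sup>2"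
proof -
  note f = assms(3)
  let ?K = hermite_indices
  define c where "c = hermite_coeff f"
  define d where "d = fluid_coeff f"
  \<comment> \<open>\<open>F\<close>, \<open>A\<close> and \<open>Q\<close> are the squared norms of
    \<open>f\<close>, \<open>P0 f\<close> and \<open>(P1 + P2) f\<close>; by orthogonality
    \<open>A\<close> and \<open>Q\<close> are also the inner products of these projections with
    \<open>f\<close>.\<close>
  define F where "F = (\<integral>v. (f v)\<^sup>2 \<partial>lebesgue)"
  define A where "A = (\<Sum>k\<in>?K. (d k)\<^sup>2)"
  define Q where "Q = (\<Sum>k\<in>?K. (c k - d k)\<^sup>2)"
  have orth: "(\<Sum>k\<in>?K. d k * (c k - d k)) = 0"
    unfolding c_def d_def by (rule fluid_coeff_orthogonal)
  have dc: "(\<Sum>k\<in>?K. d k * c k) = A"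
    using orth by (simp add: A_def algebra_simps sum_subtractf power2_eq_square)
  have qc: "(\<Sum>k\<in>?K. (c k - d k) * c k) = Q"
  proof -
    have "(\<Sum>k\<in>?K. (c k - d k) * c k) = Q + (\<Sum>k\<in>?K. d k * (c k - d k))"
      unfolding Q_def sum.distrib[symmetric]
      by (intro sum.cong) (simp_all add: algebra_simps power2_eq_square)
    then show ?thesis
      using orth by simp
  qed
  have cc: "(\<Sum>k\<in>?K. c k * c k) = A + Q"
    using dc qc by (simp add: algebra_simps sum_subtractf)
  have "0 \<le> F - 2 * (\<Sum>k\<in>?K. c k * c k) + (\<Sum>k\<in>?K. (c k)\<^sup>2)"
    unfolding F_def
    by (subst has_bochner_integral_integral_eq
        [OF has_integral_hermite_residual[OF f, of c, folded c_def], symmetric]) simp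
  then have bessel: "Q \<le> F - A"
    using cc by (simp add: power2_eq_square)
  have "Q \<ge> 0"
    by (simp add: Q_def sum_nonneg)
  have "(norm_L2v (\<lambda>v. f v - P0 f v))\<^sup>2 = (\<integral>v. (f v - P0 f v)\<^sup>2 \<partial>lebesgue)"
    by (simp add: norm_L2v_def)
  also have "\<dots> = F - 2 * (\<Sum>k\<in>?K. d k * c k) + A"
    using has_bochner_integral_integral_eq[OF has_integral_hermite_residual[OF f, of d]]
    by (simp add: P0_eq_hermite_sum[OF f] F_def A_def c_def d_def)
  finally have N: "(norm_L2v (\<lambda>v. f v - P0 f v))\<^sup>2 = F - A"
    by (simp add: dc)
  have "has_bochner_integral lebesgue (\<lambda>v. (f v)\<^sup>2) F"
    unfolding F_def using f by (intro has_bochner_integral_integrable) (simp add: L2v_def)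
  then have "has_bochner_integral lebesgue
      (\<lambda>v. 1 / (1 - \<nu>) * ((\<Sum>k\<in>?K. d k * hermite_fun k v) * f v
         + \<nu> * ((\<Sum>k\<in>?K. (c k - d k) * hermite_fun k v) * f v) - (f v)\<^sup>2))
      (1 / (1 - \<nu>) * (A + \<nu> * Q - F))"
    using has_integral_hermite_sum[OF f, of d] has_integral_hermite_sum[OF f, of "\<lambda>k. c k - d k"]
    by (intro has_bochner_integral_mult_right has_bochner_integral_add has_bochner_integral_diff)
      (simp_all flip: c_def add: dc qc)
  moreover have "L_nu \<nu> f v * f v = 1 / (1 - \<nu>) * ((\<Sum>k\<in>?K. d k * hermite_fun k v) * f v
         + \<nu> * ((\<Sum>k\<in>?K. (c k - d k) * hermite_fun k v) * f v) - (f v)\<^sup>2)" for v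
    unfolding L_nu_def P_nu_def P0_eq_hermite_sum[OF f] P1_P2_eq_hermite_sum[OF f] c_def d_def
    by (simp only: power2_eq_square ring_distribs mult.assoc)
  ultimately have L: "inner_L2v (L_nu \<nu> f) f = (A + \<nu> * Q - F) / (1 - \<nu>)"
    by (simp add: inner_L2v_def has_bochner_integral_iff)
  show ?thesis
  proof (cases "\<nu> \<ge> 0")
    case True
    \<comment> \<open>Here the minimum is 1, and the claim amounts to
      \<open>A + \<nu> * Q - F \<le> - (1 - \<nu>) * (F - A)\<close>.\<close>
    have "\<nu> * Q \<le> \<nu> * (F - A)"
      using bessel True by (rule mult_left_mono)
    then show ?thesis
      using True \<open>\<nu> < 1\<close> unfolding L N by (simp add: divide_simps) (simp add: algebra_simps)
  next
    case False
    have "\<nu> * Q \<le> 0" "\<nu> * (F - A) \<le> 0"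
      using False \<open>Q \<ge> 0\<close> bessel by (auto intro!: mult_nonpos_nonneg)
    \<comment> \<open>Dropping \<open>\<nu> * Q\<close> bounds the left side by
      \<open>- (F - A)\<close>; since \<open>\<nu> * (F - A)\<close> is nonpositive, subtracting it
      only enlarges the bound.\<close>
    then have "A + \<nu> * Q - F \<le> - ((1 + \<nu>) * (F - A))"
      by (simp add: algebra_simps)
    then have "(A + \<nu> * Q - F) / (1 - \<nu>) \<le> - ((1 + \<nu>) * (F - A)) / (1 - \<nu>)"
      by (rule divide_right_mono) (use \<open>\<nu> < 1\<close> in simp)
    moreover have "min 1 ((1 - \<bar>\<nu>\<bar>) / (1 - \<nu>)) = (1 + \<nu>) / (1 - \<nu>)"
      using False by (simp add: min_def divide_simps)
    ultimately show ?thesis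
      unfolding L N by simp
  qed
qed

end
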